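(* Let $\lambda$ be a nonzero real number, $r\ge0$ an integer and $m$ a positive integer. Then for every integer $n\ge r$, $$A_{n,\lambda}^{(r,-m)}(x)=\frac{(n)_{r}}{2^{m}}\sum_{k=0}^{m}\binom{m}{k}(k+x)_{n-r,\lambda}.$$ In particular, $A_{n,\lambda}^{(r,-m)}(0)=\frac{(n)_{r}}{2^{m}}\sum_{k=0}^{m}\binom{m}{k}(k)_{n-r,\lambda}$.
   Context: For nonzero real $\lambda$: $(x)_{0,\lambda}=1$, $(x)_{n,\lambda}=x(x-\lambda)\cdots(x-(n-1)\lambda)$ for $n\ge1$; $e_\lambda^x(t)=(1+\lambda t)^{x/\lambda}=\sum_{n\ge0}(x)_{n,\lambda}\frac{t^n}{n!}$, $e_\lambda(t)=e_\lambda^1(t)$. Ordinary falling factorial: $(y)_0=1$, $(y)_r=y(y-1)\cdots(y-r+1)$. For nonzero $\alpha\in\mathbb{C}$ and integer $r\ge0$, the generalized degenerate Euler-Genocchi polynomials of order $\alpha$ are defined by $t^{r}\Big(\frac{2}{e_{\lambda}(t)+1}\Big)^{\alpha}e_{\lambda}^{x}(t)=\sum_{n=0}^{\infty}A_{n,\lambda}^{(r,\alpha)}(x)\frac{t^{n}}{n!}$ (here with $\alpha=-m$). *)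

theory Defs
  imports Complex_Main "HOL-Computational_Algebra.Formal_Power_Series"
begin

definition falling_fact :: "complex \<Rightarrow> nat \<Rightarrow> complex" where
  "falling_fact y r = (\<Prod>i<r. y - of_nat i)"

definition deg_falling_fact :: "real \<Rightarrow> complex \<Rightarrow> nat \<Rightarrow> complex" where
  "deg_falling_fact lam x n = (\<Prod>i<n. x - of_nat i * of_real lam)"

text \<open>
  Complex power of a formal power series with constant term 1, via the binomial series
  \<open>(1 + u) ^ \<alpha> = (\<Sum>k. (\<alpha> gchoose k) * u ^ k)\<close> with \<open>u = f - 1\<close>. This is the expansion
  at 0 of the principal branch. For other constant terms the value is not meaningful.
\<close>
definition fps_cpow :: "complex fps \<Rightarrow> complex \<Rightarrow> complex fps" where
  "fps_cpow f \<alpha> = fps_binomial \<alpha> oo (f - 1)"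

definition deg_exp :: "real \<Rightarrow> complex \<Rightarrow> complex fps" where
  "deg_exp lam x = fps_cpow (1 + fps_const (of_real lam) * fps_X) (x / of_real lam)"

text \<open>
  The series \<open>2 / (deg_exp lam 1 + 1)\<close> has constant term 1, so its complex powers make sense.
\<close>
definition gen_deg_euler_genocchi :: "real \<Rightarrow> nat \<Rightarrow> complex \<Rightarrow> nat \<Rightarrow> complex \<Rightarrow> complex" where
  "gen_deg_euler_genocchi lam r \<alpha> n x =
     fact n * fps_nth (fps_X ^ r * fps_cpow (2 / (deg_exp lam 1 + 1)) \<alpha> * deg_exp lam x) n"

lemma deg_exp_nth:
  assumes "lam \<noteq> 0"
  shows "fps_nth (deg_exp lam x) n = deg_falling_fact lam x n / fact n"
proof -
  let ?l = "complex_of_real lam"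
  have "fps_nth (deg_exp lam x) n = ((x / ?l) gchoose n) * ?l ^ n"
    by (simp add: deg_exp_def fps_cpow_def fps_nth_compose_linear)
  also have "\<dots> = (\<Prod>i<n. (x / ?l - of_nat i) * ?l) / fact n"
    by (simp add: gbinomial_prod_rev prod.distrib atLeast0LessThan)
  also have "(\<Prod>i<n. (x / ?l - of_nat i) * ?l) = deg_falling_fact lam x n"
    unfolding deg_falling_fact_def using assms by (intro prod.cong) (auto simp: field_simps)
  finally show ?thesis .
qed

lemma two_div_deg_exp_nth_0:
  assumes "lam \<noteq> 0"
  shows "fps_nth (2 / (deg_exp lam 1 + 1)) 0 = 1"
  using assms by (simp add: fps_divide_unit deg_exp_nth deg_falling_fact_def fps_numeral_nth)

end

theory Submission
  imports Defs
begin

text \<open>For exponent -m the factor \<open>2 / (deg_exp lam 1 + 1)\<close> turns over: its power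
  is the m-th power of \<open>deg_exp lam 1 + 1\<close> divided by 2^m
  (\<open>fps_cpow_two_div_deg_exp\<close>). The binomial theorem and the exponential law
  \<open>deg_exp_add\<close> turn its product with \<open>deg_exp lam x\<close> into a sum of series
  \<open>deg_exp lam (of_nat k + x)\<close>, whose coefficients are degenerate falling factorials
  over factorials. The factor \<open>fps_X ^ r\<close> shifts the index to n - r, and n!/(n-r)! is
  the falling factorial (\<open>fact_eq_falling_fact\<close>).\<close>

lemma fps_cpow_of_nat: "fps_nth f 0 = 1 \<Longrightarrow> fps_cpow f (of_nat m) = f ^ m"
  by (simp add: fps_cpow_def fps_binomial_of_nat fps_compose_power [symmetric]
      fps_compose_add_distrib)

text \<open>Binomial series multiply by adding exponents (Vandermonde). Constant term 1 lets
  \<open>f - 1\<close> be substituted, and substitution respects products.\<close>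

lemma fps_cpow_add:
  assumes "fps_nth f 0 = 1"
  shows "fps_cpow f (\<alpha> + \<beta>) = fps_cpow f \<alpha> * fps_cpow f \<beta>"
  using assms by (simp add: fps_cpow_def fps_binomial_add_mult fps_compose_mult_distrib)

lemma fps_cpow_0: "fps_cpow f 0 = 1"
  by (simp add: fps_cpow_def)

lemma deg_exp_add: "deg_exp lam (x + y) = deg_exp lam x * deg_exp lam y"
  by (simp add: deg_exp_def add_divide_distrib fps_cpow_add)

lemma deg_exp_of_nat: "deg_exp lam (of_nat k) = deg_exp lam 1 ^ k"
  by (induction k) (simp_all add: deg_exp_add fps_cpow_0, simp add: deg_exp_def fps_cpow_0)

text \<open>A power with exponent -m is given by a binomial series, not as a reciprocal; additivity
  of exponents identifies it as the inverse of the ordinary m-th power.\<close>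

lemma fps_cpow_two_div_deg_exp:
  assumes "lam \<noteq> 0"
  shows "2 ^ m * fps_cpow (2 / (deg_exp lam 1 + 1)) (- of_nat m) = (deg_exp lam 1 + 1) ^ m"
proof -
  define E where "E = deg_exp lam 1 + 1"
  have c: "fps_nth (2 / E) 0 = 1"
    using two_div_deg_exp_nth_0 [OF assms] by (simp add: E_def)
  \<comment> \<open>The constant term is 2, so \<open>E\<close> is a unit and \<open>2 / E\<close>
    is a genuine quotient.\<close>
  have "fps_nth E 0 \<noteq> 0"
    using assms by (simp add: E_def deg_exp_nth deg_falling_fact_def)
  then have E2: "E * (2 / E) = 2"
    by (simp add: fps_divide_unit mult.left_commute inverse_mult_eq_1')
  have "fps_cpow (2 / E) (of_nat m + - of_nat m) = 1"
    by (simp add: fps_cpow_0)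
  then have inv: "(2 / E) ^ m * fps_cpow (2 / E) (- of_nat m) = 1"
    using fps_cpow_add [OF c, of "of_nat m" "- of_nat m"] fps_cpow_of_nat [OF c, of m] by simp
  have "2 ^ m * fps_cpow (2 / E) (- of_nat m) =
      E ^ m * ((2 / E) ^ m * fps_cpow (2 / E) (- of_nat m))"
    by (subst E2 [symmetric]) (simp only: power_mult_distrib mult.assoc)
  with inv show ?thesis
    by (simp add: E_def)
qed

text \<open>Both sides are compared through the binomial coefficient, as the falling factorial is r!
  times n choose r.\<close>

lemma fact_eq_falling_fact:
  assumes "r \<le> n"
  shows "fact n = falling_fact (of_nat n) r * fact (n - r)"
proof -
  have "falling_fact (of_nat n) r = fact r * (of_nat n gchoose r)"
    by (simp add: falling_fact_def gbinomial_prod_rev atLeast0LessThan)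
  also have "\<dots> = fact r * of_nat (n choose r)"
    by (simp add: binomial_gbinomial)
  also have "\<dots> * fact (n - r) = (of_nat (fact r * fact (n - r) * (n choose r)) :: complex)"
    by simp
  finally show ?thesis
    using assms by (simp add: binomial_fact_lemma)
qed

lemma gen_deg_euler_genocchi_neg:
  assumes "lam \<noteq> 0" and "r \<le> n"
  shows "gen_deg_euler_genocchi lam r (- of_nat m) n x =
    falling_fact (of_nat n) r / 2 ^ m *
      (\<Sum>k=0..m. of_nat (m choose k) * deg_falling_fact lam (of_nat k + x) (n - r))"
proof -
  define P where "P = fps_cpow (2 / (deg_exp lam 1 + 1)) (- of_nat m)"
  have "2 ^ m * (P * deg_exp lam x) = (deg_exp lam 1 + 1) ^ m * deg_exp lam x"
    using fps_cpow_two_div_deg_exp [OF assms(1), of m] by (simp add: P_def mult.assoc [symmetric])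
  also have "\<dots> = (\<Sum>k=0..m. of_nat (m choose k) * deg_exp lam (of_nat k + x))"
    by (simp add: binomial_ring sum_distrib_right deg_exp_add deg_exp_of_nat mult.assoc
        atLeast0AtMost)
  \<comment> \<open>Written as a constant series, the scalar \<open>2 ^ m\<close> can be pulled out
    of the coefficient.\<close>
  finally have "fps_nth (fps_const (2 ^ m) * (P * deg_exp lam x)) (n - r) =
      (\<Sum>k=0..m. of_nat (m choose k) * deg_falling_fact lam (of_nat k + x) (n - r)
        / fact (n - r))"
    by (simp add: fps_sum_nth fps_of_nat [symmetric] deg_exp_nth [OF assms(1)]
        numeral_fps_const)
  then have "2 ^ m * fps_nth (P * deg_exp lam x) (n - r) =
      (\<Sum>k=0..m. of_nat (m choose k) * deg_falling_fact lam (of_nat k + x) (n - r))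
        / fact (n - r)"
    by (simp add: sum_divide_distrib)
  \<comment> \<open>Here r \<le> n matters: coefficients of \<open>fps_X ^ r * F\<close> below index
    r vanish.\<close>
  moreover have "gen_deg_euler_genocchi lam r (- of_nat m) n x =
      fact n * fps_nth (P * deg_exp lam x) (n - r)"
    using assms(2)
    by (simp add: gen_deg_euler_genocchi_def P_def mult.assoc fps_X_power_mult_nth)
  ultimately show ?thesis
    using fact_eq_falling_fact [OF assms(2)] by (simp add: field_simps)
qed

theorem theorem3:
  fixes lam :: real and r m n :: nat and x :: complex
  assumes "lam \<noteq> 0" and "m > 0" and "r \<le> n"
  shows "gen_deg_euler_genocchi lam r (- of_nat m) n x =
           falling_fact (of_nat n) r / 2 ^ m *
             (\<Sum>k=0..m. of_nat (m choose k) * deg_falling_fact lam (of_nat k + x) (n - r)) \<and>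
         gen_deg_euler_genocchi lam r (- of_nat m) n 0 =
           falling_fact (of_nat n) r / 2 ^ m *
             (\<Sum>k=0..m. of_nat (m choose k) * deg_falling_fact lam (of_nat k) (n - r))"
  using gen_deg_euler_genocchi_neg [OF assms(1,3), of m x]
    gen_deg_euler_genocchi_neg [OF assms(1,3), of m 0] by simp

end
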